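(* Let $g\in C^{1}(\mathbb{R}^{d},\mathbb{R}^{d})$ be Lipschitz continuous with constant $L>0$ with respect to the Euclidean norm (equivalently $\|Dg(z)\|\le L$ for all $z\in\mathbb{R}^d$), and let $(\varphi_t)_{t\in\mathbb{R}}$ be the flow of the ODE $\dot x=g(x)$. Let $S$ be a set and, for every $\xi\in S$, let $R^{\xi}\in C^{1}(\mathbb{R}^{d},\mathbb{R}^{d})$ satisfy $\|R^{\xi}(x)-R^{\xi}(y)\|\le\|x-y\|$ for all $x,y\in\mathbb{R}^d$ (equivalently $\|DR^{\xi}(z)\|\le 1$ for all $z\in\mathbb{R}^d$). Then for all $t\ge 0$, $k\in\mathbb{N}=\{0,1,2,\dots\}$, $t_{0},t_{1},\dots,t_{k}\ge 0$ such that $t_{0}+\dots+t_{k}=t$, $\xi_{1},\dots,\xi_{k}\in S$ and $z\in\mathbb{R}^{d}$, $$\big\|D\big(\varphi_{t_{k}}\circ R^{\xi_{k}}\circ\varphi_{t_{k-1}}\circ R^{\xi_{k-1}}\circ\cdots\circ R^{\xi_{1}}\circ\varphi_{t_{0}}\big)(z)\big\|\le\exp(Lt).$$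
   Context: $\|\cdot\|$ denotes the Euclidean norm on $\mathbb{R}^d$, and, for matrices, the operator norm with respect to the Euclidean norm; $Df$ denotes the Jacobian of $f$. For Lipschitz $g\in C^1$, the flow $\varphi\in C^1(\mathbb{R}^{d+1},\mathbb{R}^d)$, $(t,z)\mapsto\varphi_t(z)$, is the unique function such that $t\mapsto\varphi_t(z)$ solves $\frac{d}{dt}x(t)=g(x(t))$, $x(0)=z$, for every $z\in\mathbb{R}^d$. In the application, $S$ is the sample space of the random jump maps $R^\xi$ of a piecewise-deterministic Markov process. *)

theory Defs
  imports "HOL-Analysis.Analysis"
begin

text \<open>The norm of \<^typ>\<open>real^'d\<close> is the Euclidean one, but the library norm of
  \<^typ>\<open>real^'d^'d\<close> is the Frobenius norm; the operator norm of a matrix \<open>A\<close> is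
  therefore written \<open>onorm ((*v) A)\<close>.\<close>

definition C1_map :: "(real^'d \<Rightarrow> real^'d) \<Rightarrow> bool" where
  "C1_map f \<longleftrightarrow>
     (\<forall>z. f differentiable (at z)) \<and> continuous_on UNIV (\<lambda>z. jacobian f (at z))"

text \<open>Only the defining initial value problem is required, for all times in \<open>\<real>\<close>. For
  Lipschitz \<open>g\<close> it determines \<open>\<phi>\<close> uniquely; that \<open>\<phi>\<close> is \<open>C\<^sup>1\<close> when \<open>g\<close> is \<open>C\<^sup>1\<close>
  is a consequence and not part of the definition.\<close>

definition is_flow ::
  "(real^'d \<Rightarrow> real^'d) \<Rightarrow> (real \<Rightarrow> real^'d \<Rightarrow> real^'d) \<Rightarrow> bool" where
  "is_flow g \<phi> \<longleftrightarrow>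
     (\<forall>z. \<phi> 0 z = z \<and>
          (\<forall>t. ((\<lambda>s. \<phi> s z) has_vector_derivative g (\<phi> t z)) (at t)))"

text \<open>\<open>flow_jump_comp \<phi> R \<tau> \<xi> k\<close> is
  \<open>\<phi> (\<tau> k) \<circ> R (\<xi> k) \<circ> \<dots> \<circ> R (\<xi> 1) \<circ> \<phi> (\<tau> 0)\<close>; it uses
  only \<open>\<tau> 0, \<dots>, \<tau> k\<close> and \<open>\<xi> 1, \<dots>, \<xi> k\<close>.\<close>

primrec flow_jump_comp ::
  "(real \<Rightarrow> 'a \<Rightarrow> 'a) \<Rightarrow> ('s \<Rightarrow> 'a \<Rightarrow> 'a) \<Rightarrow> (nat \<Rightarrow> real) \<Rightarrow> (nat \<Rightarrow> 's)
     \<Rightarrow> nat \<Rightarrow> 'a \<Rightarrow> 'a" where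
  "flow_jump_comp \<phi> R \<tau> \<xi> 0 = \<phi> (\<tau> 0)"
| "flow_jump_comp \<phi> R \<tau> \<xi> (Suc k) =
     \<phi> (\<tau> (Suc k)) \<circ> R (\<xi> (Suc k)) \<circ> flow_jump_comp \<phi> R \<tau> \<xi> k"

end

theory Submission
  imports Defs
begin

text \<open>
  Everything follows from one estimate. If \<open>norm w' \<le> L * norm w + \<eta>\<close> along a curve, then by
  Gronwall's argument (\<open>norm_growth_of_derivative_bound\<close>) the curve grows at most like
  \<open>exp (L * t)\<close>. Applied with \<open>\<eta> = 0\<close> to the difference of two trajectories it shows that the
  time-\<open>t\<close> flow map is \<open>exp (L * t)\<close>-Lipschitz. Jumps are 1-Lipschitz, so Lipschitz constants
  multiply along the composition to \<open>exp (L * (\<tau> 0 + \<dots> + \<tau> k))\<close>, and the derivative of a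
  Lipschitz map is bounded in operator norm by the Lipschitz constant.

  The remaining point is that the flow map is differentiable in the initial value. The classical
  route solves the variational equation \<open>v' = Dg (\<phi> s z) v\<close> first; here the same Gronwall estimate
  produces the derivative without an existence theorem for that equation. The displacement
  \<open>u h = \<phi> s (z + h) - \<phi> s z\<close> satisfies the variational equation up to an error \<open>o (norm h)\<close>,
  uniformly for \<open>s\<close> in a compact interval. As that equation is linear, the combination
  \<open>u h - (\<Sum>b\<in>Basis. (h \<bullet> b / \<sigma>) *\<^sub>R u (\<sigma> *\<^sub>R b))\<close>, which vanishes at \<open>s = 0\<close>, satisfies it up to
  such an error as well, and Gronwall makes it \<open>o (norm h)\<close>, uniformly in small \<open>\<sigma> > 0\<close>. That is
  a Cauchy criterion for differentiability
  (\<open>differentiable_if_interpolated_by_axis_increments\<close>): it forces the difference quotients along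
  the axes to converge, and the limits to assemble into the derivative.
\<close>

section \<open>Growth of curves\<close>

text \<open>Gronwall's inequality for norms. The norm is not differentiable at zero, so the argument is
  run with \<open>sqrt ((norm w)\<^sup>2 + c\<^sup>2)\<close>, which dominates the norm and satisfies the same differential
  inequality, and \<open>c\<close> is sent to zero at the end.\<close>

lemma norm_growth_of_derivative_bound:
  fixes w :: "real \<Rightarrow> 'a::real_inner"
  assumes L: "L > 0" and T: "T \<ge> 0" and eta: "\<eta> \<ge> 0"
    and w': "\<And>s. 0 \<le> s \<Longrightarrow> s \<le> T \<Longrightarrow> (w has_vector_derivative w' s) (at s)"
    and bound: "\<And>s. 0 \<le> s \<Longrightarrow> s \<le> T \<Longrightarrow> norm (w' s) \<le> L * norm (w s) + \<eta>"
  shows "norm (w T) \<le> (norm (w 0) + \<eta> / L) * exp (L * T)"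
proof -
  have main: "norm (w T) \<le> (norm (w 0) + c + \<eta> / L) * exp (L * T)" if c: "c > 0" for c :: real
  proof -
    define f where "f s = sqrt (w s \<bullet> w s + c\<^sup>2)" for s
    have pos: "w s \<bullet> w s + c\<^sup>2 > 0" for s
      using c by (simp add: add_nonneg_pos)
    hence fpos: "f s > 0" for s
      unfolding f_def by simp
    have le: "norm (w s) \<le> f s" for s
      unfolding f_def norm_eq_sqrt_inner by simp
    \<comment> \<open>The integrating factor turns the differential inequality into monotonicity.\<close>
    define F where "F s = (f s + \<eta> / L) * exp (- (L * s))" for s
    have "F T \<le> F 0"
    proof (rule DERIV_nonpos_imp_nonincreasing[OF T])
      fix s assume s: "0 \<le> s" "s \<le> T"
      have "((\<lambda>s. w s \<bullet> w s) has_derivative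
          (\<lambda>h. w s \<bullet> (h *\<^sub>R w' s) + (h *\<^sub>R w' s) \<bullet> w s)) (at s)"
        using w'[OF s] unfolding has_vector_derivative_def
        by (intro has_derivative_inner) auto
      hence d: "((\<lambda>s. w s \<bullet> w s) has_real_derivative 2 * (w s \<bullet> w' s)) (at s)"
        unfolding has_field_derivative_def
        by (rule has_derivative_eq_rhs) (auto simp: inner_commute)
      have df: "(f has_real_derivative (w s \<bullet> w' s) / f s) (at s)"
        unfolding f_def
        by (rule DERIV_cong[OF DERIV_chain2[OF DERIV_real_sqrt[OF pos] DERIV_add[OF d DERIV_const]]])
          (simp add: field_simps)
      have dF: "(F has_real_derivative
          ((w s \<bullet> w' s) / f s - L * (f s + \<eta> / L)) * exp (- (L * s))) (at s)"
        unfolding F_def by (rule derivative_eq_intros df refl | simp add: algebra_simps)+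
      have "w s \<bullet> w' s \<le> norm (w s) * norm (w' s)"
        by (rule norm_cauchy_schwarz)
      also have "\<dots> \<le> f s * (L * f s + \<eta>)"
      proof (rule mult_mono)
        show "norm (w' s) \<le> L * f s + \<eta>"
          using bound[OF s] mult_left_mono[OF le[of s], of L] L by linarith
      qed (use le fpos[of s] in auto)
      finally have "(w s \<bullet> w' s) / f s \<le> L * f s + \<eta>"
        using fpos[of s] by (simp add: divide_le_eq mult.commute)
      moreover have "L * (f s + \<eta> / L) = L * f s + \<eta>"
        using L by (simp add: distrib_left)
      ultimately have "(w s \<bullet> w' s) / f s - L * (f s + \<eta> / L) \<le> 0"
        by simp
      hence "((w s \<bullet> w' s) / f s - L * (f s + \<eta> / L)) * exp (- (L * s)) \<le> 0"
        by (intro mult_nonpos_nonneg) auto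
      thus "\<exists>y. (F has_real_derivative y) (at s) \<and> y \<le> 0"
        using dF by blast
    qed
    hence "f T + \<eta> / L \<le> (f 0 + \<eta> / L) * exp (L * T)"
      unfolding F_def by (simp add: exp_minus field_simps)
    moreover have "f 0 \<le> norm (w 0) + c"
      unfolding f_def
      by (rule real_le_lsqrt) (use c in \<open>auto simp: power2_norm_eq_inner power2_sum\<close>)
    hence "(f 0 + \<eta> / L) * exp (L * T) \<le> (norm (w 0) + c + \<eta> / L) * exp (L * T)"
      by (intro mult_right_mono) auto
    moreover have "\<eta> / L \<ge> 0"
      using L eta by simp
    ultimately show ?thesis
      using le[of T] by linarith
  qed
  show ?thesis
  proof (rule field_le_epsilon)
    fix e :: real assume "e > 0"
    hence "norm (w T) \<le> (norm (w 0) + e / exp (L * T) + \<eta> / L) * exp (L * T)"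
      by (intro main) simp
    thus "norm (w T) \<le> (norm (w 0) + \<eta> / L) * exp (L * T) + e"
      by (simp add: algebra_simps)
  qed
qed

section \<open>Derivatives: Lipschitz bounds, uniform linearisation, a Cauchy criterion\<close>

lemma lipschitz_derivative_bound:
  fixes f :: "'a::real_normed_vector \<Rightarrow> 'b::real_normed_vector"
  assumes f': "(f has_derivative f') (at x)" and lip: "C-lipschitz_on UNIV f"
  shows "norm (f' v) \<le> C * norm v"
proof (cases "v = 0")
  case True
  thus ?thesis
    using f' by (simp add: has_derivative_bounded_linear linear_simps(3))
next
  case False
  have "norm (f' v) \<le> (C + e) * norm v" if e: "e > 0" for e
  proof -
    from f' e obtain d where d: "d > 0"
      and app: "\<And>y. norm (y - x) < d \<Longrightarrow> norm (f y - f x - f' (y - x)) \<le> e * norm (y - x)"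
      unfolding has_derivative_at_alt by blast
    define s where "s = d / (2 * norm v)"
    have s: "s > 0" "s * norm v < d"
      using d False by (auto simp: s_def)
    have "norm (f (x + s *\<^sub>R v) - f x - f' (s *\<^sub>R v)) \<le> e * (s * norm v)"
      using app[of "x + s *\<^sub>R v"] s by simp
    moreover have "norm (f (x + s *\<^sub>R v) - f x) \<le> C * (s * norm v)"
      using lipschitz_on_normD[OF lip, of "x + s *\<^sub>R v" x] s by simp
    moreover have "f' (s *\<^sub>R v) = s *\<^sub>R f' v"
      using f' by (simp add: has_derivative_bounded_linear linear_simps(5))
    hence "norm (f' (s *\<^sub>R v)) = s * norm (f' v)"
      using s by simp
    ultimately have "s * norm (f' v) \<le> e * (s * norm v) + C * (s * norm v)"
      using norm_triangle_ineq3[of "f (x + s *\<^sub>R v) - f x" "f' (s *\<^sub>R v)"] by linarith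
    hence "s * norm (f' v) \<le> s * ((C + e) * norm v)"
      by (simp add: algebra_simps)
    thus ?thesis
      using s by simp
  qed
  hence "norm (f' v) / norm v \<le> C + e" if "e > 0" for e
    using that False by (simp add: divide_le_eq)
  hence "norm (f' v) / norm v \<le> C"
    by (rule field_le_epsilon)
  thus ?thesis
    using False by (simp add: divide_le_eq)
qed

text \<open>The Jacobian is uniformly continuous on a compact ball slightly larger than \<open>K\<close>, and the mean
  value inequality turns its oscillation into a bound on the first-order remainder. Uniformity over
  \<open>K\<close> is what permits linearising \<open>g\<close> along a whole trajectory segment at once.\<close>

lemma C1_map_uniform_linearisation:
  fixes g :: "real^'d \<Rightarrow> real^'d"
  assumes g: "C1_map g" and K: "bounded K" and e: "e > 0"
  obtains \<delta> where "\<delta> > 0"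
    and "\<And>x y. x \<in> K \<Longrightarrow> norm (y - x) < \<delta> \<Longrightarrow>
           norm (g y - g x - jacobian g (at x) *v (y - x)) \<le> e * norm (y - x)"
proof -
  define J where "J x = jacobian g (at x)" for x
  have der: "(g has_derivative (\<lambda>h. J x *v h)) (at x)" for x
    using g unfolding C1_map_def J_def jacobian_works by blast
  have cont: "continuous_on UNIV J"
    using g unfolding C1_map_def J_def by blast
  obtain B where B: "\<And>x. x \<in> K \<Longrightarrow> norm x \<le> B"
    using K unfolding bounded_iff by blast
  define e' where "e' = e / (real CARD('d) * real CARD('d))"
  have e': "e' > 0"
    unfolding e'_def using e by simp
  have "uniformly_continuous_on (cball 0 (B + 1)) J"
    by (intro compact_uniformly_continuous continuous_on_subset[OF cont]) auto
  then obtain d where d: "d > 0"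
    and osc: "\<And>x y. x \<in> cball 0 (B + 1) \<Longrightarrow> y \<in> cball 0 (B + 1) \<Longrightarrow> dist y x < d \<Longrightarrow>
        dist (J y) (J x) < e'"
    using e' unfolding uniformly_continuous_on_def by metis
  show ?thesis
  proof (rule that)
    show "min d 1 > 0"
      using d by simp
    fix x y assume x: "x \<in> K" and y: "norm (y - x) < min d 1"
    have in_ball: "v \<in> cball 0 (B + 1)" if "v \<in> ball x (min d 1)" for v
      using that B[OF x] norm_triangle_ineq2[of v x] by (auto simp: dist_norm norm_minus_commute)
    have "norm (g y - g x - J x *v (y - x)) \<le> norm (y - x) * e"
    proof (rule differentiable_bound_linearization[where S = "ball x (min d 1)" and f' = "\<lambda>v h. J v *v h"])
      fix t :: real assume t: "t \<in> {0..1}"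
      have "t * norm (y - x) \<le> norm (y - x)"
        using t by (simp add: mult_left_le_one_le)
      thus "x + t *\<^sub>R (y - x) \<in> ball x (min d 1)"
        using t y by (auto simp: dist_norm)
    next
      fix v assume v: "v \<in> ball x (min d 1)"
      show "(g has_derivative (*v) (J v)) (at v within ball x (min d 1))"
        by (rule has_derivative_at_withinI[OF der])
      have "dist (J v) (J x) < e'"
      proof (rule osc)
        show "x \<in> cball 0 (B + 1)"
          using d by (intro in_ball) auto
      qed (use in_ball[OF v] v in \<open>auto simp: dist_commute\<close>)
      hence entries: "\<bar>(J v - J x) $ i $ j\<bar> \<le> e'" for i j
        using component_le_norm_cart[of "(J v - J x) $ i" j] Finite_Cartesian_Product.norm_nth_le[of "J v - J x" i]
        by (simp add: dist_norm)
      have "onorm ((*v) (J v - J x)) \<le> real CARD('d) * real CARD('d) * e'"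
        by (rule onorm_le_matrix_component[OF entries])
      thus "onorm ((*v) (J v) - (*v) (J x)) \<le> e"
        by (simp add: e'_def matrix_vector_mult_diff_rdistrib[abs_def] fun_diff_def)
    qed (use d in auto)
    thus "norm (g y - g x - jacobian g (at x) *v (y - x)) \<le> e * norm (y - x)"
      by (simp add: J_def mult.commute)
  qed
qed

text \<open>The hypothesis says that, near \<open>x\<close>, the increments of \<open>F\<close> agree up to \<open>o (norm h)\<close> with the
  linear map interpolating the increments along the axes at any small scale \<open>\<sigma>\<close>. For \<open>h\<close> on an
  axis this is the Cauchy property of the difference quotients; letting \<open>\<sigma>\<close> tend to zero
  identifies their limits as the columns of the derivative.\<close>

lemma differentiable_if_interpolated_by_axis_increments:
  fixes F :: "'a::euclidean_space \<Rightarrow> 'b::banach"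
  assumes interp: "\<And>\<epsilon>. \<epsilon> > 0 \<Longrightarrow> \<exists>\<delta>>0. \<forall>h \<sigma>. norm h < \<delta> \<longrightarrow> 0 < \<sigma> \<longrightarrow> \<sigma> < \<delta> \<longrightarrow>
      norm (F (x + h) - F x - (\<Sum>b\<in>Basis. (h \<bullet> b / \<sigma>) *\<^sub>R (F (x + \<sigma> *\<^sub>R b) - F x))) \<le> \<epsilon> * norm h"
  shows "F differentiable (at x)"
proof -
  define \<sigma> where "\<sigma> n = inverse (real (Suc n))" for n
  have \<sigma>pos: "\<sigma> n > 0" for n
    unfolding \<sigma>_def by simp
  have \<sigma>0: "\<sigma> \<longlonglongrightarrow> 0"
    unfolding \<sigma>_def by (rule LIMSEQ_inverse_real_of_nat)
  define q where "q b n = (F (x + \<sigma> n *\<^sub>R b) - F x) /\<^sub>R \<sigma> n" for b n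
  have q_Cauchy: "Cauchy (q b)" if b: "b \<in> Basis" for b
  proof (rule metric_CauchyI)
    fix e :: real assume "e > 0"
    hence "e / 2 > 0" by simp
    from interp[OF this] obtain \<delta> where \<delta>: "\<delta> > 0" and
      app: "\<And>h s. norm h < \<delta> \<Longrightarrow> 0 < s \<Longrightarrow> s < \<delta> \<Longrightarrow>
        norm (F (x + h) - F x - (\<Sum>b\<in>Basis. (h \<bullet> b / s) *\<^sub>R (F (x + s *\<^sub>R b) - F x)))
          \<le> e / 2 * norm h"
      by blast
    obtain N where N: "\<And>n. n \<ge> N \<Longrightarrow> \<sigma> n < \<delta>"
      using order_tendstoD(2)[OF \<sigma>0 \<delta>] unfolding eventually_sequentially by blast
    have "dist (q b m) (q b n) < e" if "m \<ge> N" "n \<ge> N" for m n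
    proof -
      have "(\<Sum>c\<in>Basis. (\<sigma> m *\<^sub>R b \<bullet> c / \<sigma> n) *\<^sub>R (F (x + \<sigma> n *\<^sub>R c) - F x))
          = (\<Sum>c\<in>Basis. if c = b then \<sigma> m *\<^sub>R q b n else 0)"
        by (intro sum.cong refl) (use b in \<open>auto simp: inner_Basis q_def field_simps\<close>)
      also have "\<dots> = \<sigma> m *\<^sub>R q b n"
        using b by simp
      finally have "norm (F (x + \<sigma> m *\<^sub>R b) - F x - \<sigma> m *\<^sub>R q b n) \<le> e / 2 * \<sigma> m"
        using app[of "\<sigma> m *\<^sub>R b" "\<sigma> n"] N that \<sigma>pos[of m] \<sigma>pos[of n] b by simp
      moreover have "F (x + \<sigma> m *\<^sub>R b) - F x = \<sigma> m *\<^sub>R q b m"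
        using \<sigma>pos[of m] by (simp add: q_def)
      hence "F (x + \<sigma> m *\<^sub>R b) - F x - \<sigma> m *\<^sub>R q b n = \<sigma> m *\<^sub>R (q b m - q b n)"
        by (simp add: scaleR_diff_right)
      ultimately have "\<sigma> m * norm (q b m - q b n) \<le> \<sigma> m * (e / 2)"
        using \<sigma>pos[of m] by (simp add: mult.commute)
      thus ?thesis
        using \<sigma>pos[of m] \<open>e > 0\<close> by (simp add: dist_norm)
    qed
    thus "\<exists>N. \<forall>m\<ge>N. \<forall>n\<ge>N. dist (q b m) (q b n) < e"
      by blast
  qed
  define D where "D b = lim (q b)" for b
  have D: "q b \<longlonglongrightarrow> D b" if "b \<in> Basis" for b
    using Cauchy_convergent[OF q_Cauchy[OF that]] unfolding D_def by (simp add: convergent_LIMSEQ_iff)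
  have "(F has_derivative (\<lambda>h. \<Sum>b\<in>Basis. (h \<bullet> b) *\<^sub>R D b)) (at x)"
    unfolding has_derivative_at_alt
  proof (intro conjI allI impI)
    show "bounded_linear (\<lambda>h. \<Sum>b\<in>Basis. (h \<bullet> b) *\<^sub>R D b)"
      by (intro bounded_linear_sum bounded_linear_scaleR_const bounded_linear_inner_left)
    fix e :: real assume "e > 0"
    from interp[OF this] obtain \<delta> where \<delta>: "\<delta> > 0" and
      app: "\<And>h s. norm h < \<delta> \<Longrightarrow> 0 < s \<Longrightarrow> s < \<delta> \<Longrightarrow>
        norm (F (x + h) - F x - (\<Sum>b\<in>Basis. (h \<bullet> b / s) *\<^sub>R (F (x + s *\<^sub>R b) - F x)))
          \<le> e * norm h"
      by blast
    have "norm (F y - F x - (\<Sum>b\<in>Basis. ((y - x) \<bullet> b) *\<^sub>R D b)) \<le> e * norm (y - x)"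
      if y: "norm (y - x) < \<delta>" for y
    proof (rule tendsto_upperbound)
      show "(\<lambda>n. norm (F y - F x - (\<Sum>b\<in>Basis. ((y - x) \<bullet> b) *\<^sub>R q b n)))
          \<longlonglongrightarrow> norm (F y - F x - (\<Sum>b\<in>Basis. ((y - x) \<bullet> b) *\<^sub>R D b))"
        by (intro tendsto_intros D)
      show "\<forall>\<^sub>F n in sequentially.
          norm (F y - F x - (\<Sum>b\<in>Basis. ((y - x) \<bullet> b) *\<^sub>R q b n)) \<le> e * norm (y - x)"
        using order_tendstoD(2)[OF \<sigma>0 \<delta>]
      proof eventually_elim
        case (elim n)
        show ?case
          using app[OF y \<sigma>pos elim] by (simp add: q_def divide_inverse)
      qed
    qed simp
    thus "\<exists>d>0. \<forall>y. norm (y - x) < d \<longrightarrow>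
        norm (F y - F x - (\<Sum>b\<in>Basis. ((y - x) \<bullet> b) *\<^sub>R D b)) \<le> e * norm (y - x)"
      using \<delta> by blast
  qed
  thus ?thesis
    unfolding differentiable_def by blast
qed

section \<open>The flow map\<close>

lemma flow_lipschitz:
  assumes L: "L > 0" and lip: "L-lipschitz_on UNIV g" and flow: "is_flow g \<phi>" and T: "T \<ge> 0"
  shows "(exp (L * T))-lipschitz_on UNIV (\<phi> T)"
proof (rule lipschitz_onI)
  fix x y
  have "norm (\<phi> T x - \<phi> T y) \<le> (norm (\<phi> 0 x - \<phi> 0 y) + 0 / L) * exp (L * T)"
  proof (rule norm_growth_of_derivative_bound[OF L T,
        where w = "\<lambda>s. \<phi> s x - \<phi> s y" and w' = "\<lambda>s. g (\<phi> s x) - g (\<phi> s y)"])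
    fix s
    show "((\<lambda>s. \<phi> s x - \<phi> s y) has_vector_derivative g (\<phi> s x) - g (\<phi> s y)) (at s)"
      using flow unfolding is_flow_def by (intro has_vector_derivative_diff) auto
    show "norm (g (\<phi> s x) - g (\<phi> s y)) \<le> L * norm (\<phi> s x - \<phi> s y) + 0"
      using lipschitz_on_normD[OF lip, of "\<phi> s x" "\<phi> s y"] by simp
  qed simp
  thus "dist (\<phi> T x) (\<phi> T y) \<le> exp (L * T) * dist x y"
    using flow by (simp add: is_flow_def dist_norm mult.commute)
qed simp

lemma flow_differentiable:
  fixes g :: "real^'d \<Rightarrow> real^'d"
  assumes g: "C1_map g" and L: "L > 0" and lip: "L-lipschitz_on UNIV g"
    and flow: "is_flow g \<phi>" and T: "T \<ge> 0"
  shows "\<phi> T differentiable (at z)"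
proof (rule differentiable_if_interpolated_by_axis_increments)
  fix \<epsilon> :: real assume \<epsilon>: "\<epsilon> > 0"
  define K where "K = exp (L * T)"
  have K: "K > 0"
    unfolding K_def by simp
  define N where "N = 1 + real (card (Basis :: (real^'d) set))"
  have N: "N > 0"
    unfolding N_def by simp
  define A where "A s = jacobian g (at (\<phi> s z))" for s
  define u where "u h s = \<phi> s (z + h) - \<phi> s z" for h s
  define r where "r h s = g (\<phi> s (z + h)) - g (\<phi> s z) - A s *v u h s" for h s
  have phi0: "\<phi> 0 y = y" for y
    using flow by (simp add: is_flow_def)
  have phi': "((\<lambda>s. \<phi> s y) has_vector_derivative g (\<phi> s y)) (at s)" for y s
    using flow by (simp add: is_flow_def)
  have u': "(u h has_vector_derivative A s *v u h s + r h s) (at s)" for h s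
    using has_vector_derivative_diff[OF phi' phi'] by (simp add: r_def u_def[abs_def])
  have u_le: "norm (u h s) \<le> K * norm h" if s: "0 \<le> s" "s \<le> T" for h s
  proof -
    have "norm (u h s) \<le> exp (L * s) * norm h"
      using lipschitz_on_normD[OF flow_lipschitz[OF L lip flow s(1)], of "z + h" z]
      by (simp add: u_def)
    also have "\<dots> \<le> K * norm h"
      unfolding K_def using L s by (intro mult_right_mono) auto
    finally show ?thesis .
  qed
  have A_le: "norm (A s *v v) \<le> L * norm v" for s v
  proof (rule lipschitz_derivative_bound[OF _ lip])
    show "(g has_derivative (\<lambda>h. A s *v h)) (at (\<phi> s z))"
      using g unfolding C1_map_def A_def jacobian_works by blast
  qed

  \<comment> \<open>The remainder enters the final bound through the factor \<open>K\<close> from \<open>u_le\<close>, the factor \<open>K / L\<close>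
    from Gronwall, and \<open>N\<close> for the \<open>N\<close> terms of the linear combination.\<close>
  define e where "e = \<epsilon> * L / (K * K * N)"
  have e: "e > 0"
    unfolding e_def using \<epsilon> L K N by simp
  have "continuous_on {0..T} (\<lambda>s. \<phi> s z)"
    using phi' by (meson continuous_at_imp_continuous_on has_vector_derivative_continuous)
  hence "bounded ((\<lambda>s. \<phi> s z) ` {0..T})"
    by (intro compact_imp_bounded compact_continuous_image) auto
  from C1_map_uniform_linearisation[OF g this e] obtain d where d: "d > 0"
    and lin: "\<And>x y. x \<in> (\<lambda>s. \<phi> s z) ` {0..T} \<Longrightarrow> norm (y - x) < d \<Longrightarrow>
        norm (g y - g x - jacobian g (at x) *v (y - x)) \<le> e * norm (y - x)"
    by metis
  have r_le: "norm (r h s) \<le> e * K * norm h" if h: "norm h < d / K" and s: "0 \<le> s" "s \<le> T" for h s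
  proof -
    have "K * norm h < d"
      using h K by (simp add: field_simps)
    hence "norm (u h s) < d"
      using u_le[OF s, of h] by linarith
    hence "norm (r h s) \<le> e * norm (u h s)"
      using lin[of "\<phi> s z" "\<phi> s (z + h)"] s by (simp add: r_def u_def A_def)
    also have "\<dots> \<le> e * (K * norm h)"
      using e u_le[OF s] by (intro mult_left_mono) auto
    finally show ?thesis by simp
  qed

  show "\<exists>\<delta>>0. \<forall>h \<sigma>. norm h < \<delta> \<longrightarrow> 0 < \<sigma> \<longrightarrow> \<sigma> < \<delta> \<longrightarrow>
      norm (\<phi> T (z + h) - \<phi> T z
        - (\<Sum>b\<in>Basis. (h \<bullet> b / \<sigma>) *\<^sub>R (\<phi> T (z + \<sigma> *\<^sub>R b) - \<phi> T z))) \<le> \<epsilon> * norm h"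
  proof (intro exI[of _ "d / K"] conjI allI impI)
    show "d / K > 0"
      using d K by simp
    fix h :: "real^'d" and \<sigma> :: real
    assume h: "norm h < d / K" and \<sigma>: "0 < \<sigma>" "\<sigma> < d / K"
    define c where "c b = h \<bullet> b / \<sigma>" for b
    define w where "w s = u h s - (\<Sum>b\<in>Basis. c b *\<^sub>R u (\<sigma> *\<^sub>R b) s)" for s
    define \<rho> where "\<rho> s = r h s - (\<Sum>b\<in>Basis. c b *\<^sub>R r (\<sigma> *\<^sub>R b) s)" for s
    have w': "(w has_vector_derivative A s *v w s + \<rho> s) (at s)" for s
    proof -
      have "(w has_vector_derivative (A s *v u h s + r h s)
          - (\<Sum>b\<in>Basis. c b *\<^sub>R (A s *v u (\<sigma> *\<^sub>R b) s + r (\<sigma> *\<^sub>R b) s))) (at s)"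
        unfolding w_def
        by (intro has_vector_derivative_diff has_vector_derivative_sum u'
            bounded_linear.has_vector_derivative[OF bounded_linear_scaleR_right])
      moreover have "(A s *v u h s + r h s)
          - (\<Sum>b\<in>Basis. c b *\<^sub>R (A s *v u (\<sigma> *\<^sub>R b) s + r (\<sigma> *\<^sub>R b) s)) = A s *v w s + \<rho> s"
        by (simp add: w_def \<rho>_def scaleR_add_right sum.distrib linear_diff[OF matrix_vector_mul_linear]
            linear_sum[OF matrix_vector_mul_linear] linear_cmul[OF matrix_vector_mul_linear])
      ultimately show ?thesis by simp
    qed
    have rho_le: "norm (\<rho> s) \<le> e * K * N * norm h" if s: "0 \<le> s" "s \<le> T" for s
    proof -
      have "norm (c b *\<^sub>R r (\<sigma> *\<^sub>R b) s) \<le> e * K * norm h" if b: "b \<in> Basis" for b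
      proof -
        have "norm (r (\<sigma> *\<^sub>R b) s) \<le> e * K * \<sigma>"
          using r_le[of "\<sigma> *\<^sub>R b" s] s \<sigma> b by simp
        hence "norm (c b *\<^sub>R r (\<sigma> *\<^sub>R b) s) \<le> \<bar>c b\<bar> * (e * K * \<sigma>)"
          by (simp add: mult_left_mono)
        also have "\<dots> = e * K * \<bar>h \<bullet> b\<bar>"
          using \<sigma> by (simp add: c_def abs_divide)
        also have "\<dots> \<le> e * K * norm h"
          using e K b by (intro mult_left_mono) (auto simp: Basis_le_norm)
        finally show ?thesis .
      qed
      hence "norm (\<Sum>b\<in>Basis. c b *\<^sub>R r (\<sigma> *\<^sub>R b) s)
          \<le> real (card (Basis :: (real^'d) set)) * (e * K * norm h)"
        by (rule sum_norm_bound)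
      moreover have "norm (r h s) \<le> e * K * norm h"
        using r_le[OF h s] .
      ultimately have "norm (\<rho> s)
          \<le> e * K * norm h + real (card (Basis :: (real^'d) set)) * (e * K * norm h)"
        unfolding \<rho>_def by (intro order_trans[OF norm_triangle_ineq4] add_mono)
      thus ?thesis
        by (simp add: N_def algebra_simps)
    qed
    have "w 0 = 0"
    proof -
      have "(\<Sum>b\<in>Basis. c b *\<^sub>R u (\<sigma> *\<^sub>R b) 0) = (\<Sum>b\<in>Basis. (h \<bullet> b) *\<^sub>R b)"
        using \<sigma> by (simp add: u_def phi0 c_def)
      thus ?thesis
        by (simp add: w_def u_def phi0 euclidean_representation)
    qed
    moreover have "norm (w T) \<le> (norm (w 0) + e * K * N * norm h / L) * exp (L * T)"
    proof (rule norm_growth_of_derivative_bound[OF L T, where w' = "\<lambda>s. A s *v w s + \<rho> s"])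
      show "e * K * N * norm h \<ge> 0"
        using e K N by simp
      fix s assume s: "0 \<le> s" "s \<le> T"
      show "norm (A s *v w s + \<rho> s) \<le> L * norm (w s) + e * K * N * norm h"
        by (intro order_trans[OF norm_triangle_ineq] add_mono A_le rho_le s)
    qed (rule w')
    ultimately have "norm (w T) \<le> e * K * N * norm h / L * K"
      by (simp add: K_def)
    also have "\<dots> = \<epsilon> * norm h"
      using K N L by (simp add: e_def field_simps)
    finally show "norm (\<phi> T (z + h) - \<phi> T z
        - (\<Sum>b\<in>Basis. (h \<bullet> b / \<sigma>) *\<^sub>R (\<phi> T (z + \<sigma> *\<^sub>R b) - \<phi> T z))) \<le> \<epsilon> * norm h"
      by (simp add: w_def u_def c_def)
  qed
qed

section \<open>Composition with jumps\<close>

lemma flow_jump_comp_differentiable_lipschitz: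
  fixes g :: "real^'d \<Rightarrow> real^'d" and R :: "'s \<Rightarrow> real^'d \<Rightarrow> real^'d"
  assumes g: "C1_map g" and L: "L > 0" and lip: "L-lipschitz_on UNIV g" and flow: "is_flow g \<phi>"
    and R: "\<And>i. i \<in> {1..k} \<Longrightarrow> C1_map (R (\<xi> i)) \<and> 1-lipschitz_on UNIV (R (\<xi> i))"
    and \<tau>: "\<And>i. i \<in> {0..k} \<Longrightarrow> \<tau> i \<ge> 0"
  shows "(\<forall>z. flow_jump_comp \<phi> R \<tau> \<xi> k differentiable (at z)) \<and>
    (exp (L * (\<Sum>i=0..k. \<tau> i)))-lipschitz_on UNIV (flow_jump_comp \<phi> R \<tau> \<xi> k)"
  using R \<tau>
proof (induction k)
  case 0
  thus ?case
    using flow_differentiable[OF g L lip flow] flow_lipschitz[OF L lip flow] by simp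
next
  case (Suc k)
  let ?H = "flow_jump_comp \<phi> R \<tau> \<xi> k"
  let ?G = "R (\<xi> (Suc k)) \<circ> ?H"
  have IH: "?H differentiable (at z)"
    "(exp (L * (\<Sum>i=0..k. \<tau> i)))-lipschitz_on UNIV ?H" for z
    using Suc by auto
  have jump: "C1_map (R (\<xi> (Suc k)))" "1-lipschitz_on UNIV (R (\<xi> (Suc k)))"
    and T: "\<tau> (Suc k) \<ge> 0"
    using Suc.prems by auto
  have "?G differentiable (at z)" for z
    using jump(1) by (intro differentiable_chain_at IH) (simp add: C1_map_def)
  hence "(\<phi> (\<tau> (Suc k)) \<circ> ?G) differentiable (at z)" for z
    by (rule differentiable_chain_at[OF _ flow_differentiable[OF g L lip flow T]])
  moreover have "(exp (L * \<tau> (Suc k)) * (1 * exp (L * (\<Sum>i=0..k. \<tau> i))))-lipschitz_on UNIV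
      (\<phi> (\<tau> (Suc k)) \<circ> ?G)"
    by (intro lipschitz_on_compose IH lipschitz_on_subset[OF jump(2)]
        lipschitz_on_subset[OF flow_lipschitz[OF L lip flow T]]) auto
  hence "(exp (L * (\<Sum>i=0..Suc k. \<tau> i)))-lipschitz_on UNIV (\<phi> (\<tau> (Suc k)) \<circ> ?G)"
    by (simp add: exp_add[symmetric] algebra_simps)
  ultimately show ?case
    by (simp add: comp_def)
qed

theorem proposition3p3:
  fixes g :: "real^'d \<Rightarrow> real^'d"
    and L :: real
    and \<phi> :: "real \<Rightarrow> real^'d \<Rightarrow> real^'d"
    and S :: "'s set"
    and R :: "'s \<Rightarrow> real^'d \<Rightarrow> real^'d"
    and t :: real
    and k :: nat
    and \<tau> :: "nat \<Rightarrow> real"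
    and \<xi> :: "nat \<Rightarrow> 's"
    and z :: "real^'d"
  assumes "C1_map g"
    and "L > 0"
    and "L-lipschitz_on UNIV g"
    and "is_flow g \<phi>"
    and "\<And>\<eta>. \<eta> \<in> S \<Longrightarrow> C1_map (R \<eta>)"
    and "\<And>\<eta> x y. \<eta> \<in> S \<Longrightarrow> norm (R \<eta> x - R \<eta> y) \<le> norm (x - y)"
    and "t \<ge> 0"
    and "\<And>i. i \<in> {0..k} \<Longrightarrow> \<tau> i \<ge> 0"
    and "(\<Sum>i=0..k. \<tau> i) = t"
    and "\<And>i. i \<in> {1..k} \<Longrightarrow> \<xi> i \<in> S"
  shows "flow_jump_comp \<phi> R \<tau> \<xi> k differentiable (at z) \<and>
         onorm ((*v) (jacobian (flow_jump_comp \<phi> R \<tau> \<xi> k) (at z))) \<le> exp (L * t)"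
proof -
  have "C1_map (R (\<xi> i)) \<and> 1-lipschitz_on UNIV (R (\<xi> i))" if "i \<in> {1..k}" for i
    using assms(5,6) assms(10)[OF that] by (auto intro!: lipschitz_onI simp: dist_norm)
  hence "(\<forall>z. flow_jump_comp \<phi> R \<tau> \<xi> k differentiable (at z)) \<and>
    (exp (L * (\<Sum>i=0..k. \<tau> i)))-lipschitz_on UNIV (flow_jump_comp \<phi> R \<tau> \<xi> k)"
    by (rule flow_jump_comp_differentiable_lipschitz[OF assms(1-4) _ assms(8)])
  hence diff: "flow_jump_comp \<phi> R \<tau> \<xi> k differentiable (at z)"
    and lip: "(exp (L * t))-lipschitz_on UNIV (flow_jump_comp \<phi> R \<tau> \<xi> k)"
    by (auto simp: assms(9))
  have "onorm ((*v) (jacobian (flow_jump_comp \<phi> R \<tau> \<xi> k) (at z))) \<le> exp (L * t)"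
    using lipschitz_derivative_bound[OF _ lip] diff by (intro onorm_le) (auto simp: jacobian_works)
  with diff show ?thesis
    by blast
qed

end
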